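(* Let $T$ be a tree with $n\geq 3$ vertices. Then $u(T)\geq\left\lfloor\dfrac{n+3}{5}\right\rfloor$.
   Context: The Toucher-Isolator game on a finite graph $G$ is played by two players, Toucher and Isolator, who alternately claim a previously unclaimed edge of $G$, with Toucher moving first, until all edges have been claimed. A vertex is touched if it is incident to at least one edge claimed by Toucher, and untouched if all edges incident to it are claimed by Isolator. The score of the game is the number of untouched vertices once all edges have been claimed. Toucher aims to minimize the score and Isolator aims to maximize it. $u(G)$ denotes the score of the game on $G$ when both players play optimally. *)

theory Defs
  imports Complex_Main
begin

text \<open>
  A finite simple graph is a finite vertex set together with a set of edges, each edge being a
  two-element set of vertices.  The notion of tree for digraphs in the AFP entry \<open>Graph_Theory\<close> is
  not usable here: its cycles are directed, so a pair of antiparallel arcs counts as a cycle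
  whereas an acyclically oriented triangle does not.
\<close>

definition simple_graph :: "'a set \<Rightarrow> 'a set set \<Rightarrow> bool" where
  "simple_graph V E \<longleftrightarrow> finite V \<and> (\<forall>e\<in>E. e \<subseteq> V \<and> card e = 2)"

definition connected_graph :: "'a set \<Rightarrow> 'a set set \<Rightarrow> bool" where
  "connected_graph V E \<longleftrightarrow> V \<noteq> {} \<and> (\<forall>u\<in>V. \<forall>v\<in>V. (u, v) \<in> {(x, y). {x, y} \<in> E}\<^sup>*)"

text \<open>A cycle is given by the cyclic list of its vertices, without repeating the start vertex.\<close>

definition graph_cycle :: "'a set set \<Rightarrow> 'a list \<Rightarrow> bool" where
  "graph_cycle E p \<longleftrightarrow> length p \<ge> 3 \<and> distinct p \<and>
     (\<forall>i<length p. {p ! i, p ! (Suc i mod length p)} \<in> E)"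

definition tree_graph :: "'a set \<Rightarrow> 'a set set \<Rightarrow> bool" where
  "tree_graph V E \<longleftrightarrow> simple_graph V E \<and> connected_graph V E \<and> (\<nexists>p. graph_cycle E p)"

definition untouched :: "'a set \<Rightarrow> 'a set set \<Rightarrow> 'a set set \<Rightarrow> 'a set" where
  "untouched V E I = {v \<in> V. \<forall>e\<in>E. v \<in> e \<longrightarrow> e \<in> I}"

datatype player = Toucher | Isolator

text \<open>
  The score under optimal play from the position where \<open>T\<close> and \<open>I\<close> are the sets of edges already
  claimed by Toucher and by Isolator, with the given player to move (backward induction).
  The case of an infinite set of unclaimed edges is a dummy that makes the recursion total.
\<close>

function position_value ::
  "'a set \<Rightarrow> 'a set set \<Rightarrow> player \<Rightarrow> 'a set set \<Rightarrow> 'a set set \<Rightarrow> nat" where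
  "position_value V E Toucher T I =
     (if infinite (E - (T \<union> I)) \<or> E - (T \<union> I) = {} then card (untouched V E I)
      else Min ((\<lambda>e. position_value V E Isolator (insert e T) I) ` (E - (T \<union> I))))"
| "position_value V E Isolator T I =
     (if infinite (E - (T \<union> I)) \<or> E - (T \<union> I) = {} then card (untouched V E I)
      else Max ((\<lambda>e. position_value V E Toucher T (insert e I)) ` (E - (T \<union> I))))"
  by pat_completeness auto
termination
proof (relation "measure (\<lambda>(V, E, pl, T, I). card (E - (T \<union> I)))", goal_cases)
  case (2 V E T I e)
  then have "E - (insert e T \<union> I) \<subset> E - (T \<union> I)" by blast
  with 2 show ?case by (simp add: psubset_card_mono del: Un_insert_left)
next
  case (3 V E T I e)
  then have "E - (T \<union> insert e I) \<subset> E - (T \<union> I)" by blast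
  with 3 show ?case by (simp add: psubset_card_mono del: Un_insert_right)
qed simp

declare position_value.simps [simp del]

definition game_value :: "'a set \<Rightarrow> 'a set set \<Rightarrow> nat" where
  "game_value V E = position_value V E Toucher {} {}"

end

theory Submission
  imports Defs
begin

text \<open>
  Call a vertex alive if Toucher has not touched it, and consider only the unclaimed edges.  Give
  the position the potential 4 per alive vertex, plus 1 more per isolated alive vertex (a secured
  point is thus worth 5), minus 3 per edge with two alive ends and 2 per edge with exactly one.
  A tree starts at \<open>4 n - 3 (n - 1) = n + 3\<close> and Toucher's first move costs at most 4, so it
  suffices that from then on Isolator, having the move, never lets the potential drop in the long
  run: the score is then at least \<open>(n - 1) / 5\<close>.

  Isolating a leaf whose neighbour is alive gains 4 and Toucher's reply costs at most 4; indeed it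
  costs at most 3 unless Toucher touches such a leaf.  Isolating a leaf with a touched neighbour
  gains 3, and so does cutting an edge with two alive ends.  If there is no leaf, Isolator takes a
  vertex \<open>v\<close> with a single alive neighbour \<open>w\<close> (a leaf of the alive forest) and cuts \<open>vw\<close>, unless
  this turns \<open>w\<close> into a leaf with another alive neighbour \<open>x\<close>; then he cuts \<open>wx\<close> instead.  Only
  the reply at \<open>x\<close> costs 4, but after it Isolator isolates \<open>w\<close>, which gains 4 and leaves no leaf
  with an alive neighbour, so the lost unit is recovered.
\<close>

section \<open>Potential, leaves and invariants of a position\<close>

definition cost :: "'a set \<Rightarrow> 'a set \<Rightarrow> int" where
  "cost A e = (if e \<inter> A = {} then 0 else int (card (e \<inter> A)) + 1)"

definition potential :: "'a set \<Rightarrow> 'a set set \<Rightarrow> int" where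
  "potential A F = 4 * int (card A) + int (card {v \<in> A. \<forall>f\<in>F. v \<notin> f}) - (\<Sum>f\<in>F. cost A f)"

definition leaf :: "'a set set \<Rightarrow> 'a \<Rightarrow> 'a \<Rightarrow> bool" where
  "leaf F l w \<longleftrightarrow> {f \<in> F. l \<in> f} = {{l, w}}"

text \<open>Every component that has an edge contains a touched vertex: \<open>A\<close> is the set of alive ones.\<close>

definition anchored :: "'a set \<Rightarrow> 'a set set \<Rightarrow> bool" where
  "anchored A F \<longleftrightarrow>
     (\<forall>S\<subseteq>A. (\<forall>f\<in>F. f \<inter> S \<noteq> {} \<longrightarrow> f \<subseteq> S) \<longrightarrow> (\<forall>f\<in>F. f \<inter> S = {}))"

text \<open>For edges of size 2 this is the counting form of being a forest. It passes to subsets of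
  the edges at once and feeds directly into degree sums. Finiteness of \<open>S\<close> keeps
  \<open>card S\<close> from being the default 0.\<close>

definition edge_sparse :: "'a set set \<Rightarrow> bool" where
  "edge_sparse F \<longleftrightarrow> (\<forall>S. finite S \<and> S \<noteq> {} \<longrightarrow> card {f \<in> F. f \<subseteq> S} < card S)"

text \<open>
  The position in which Isolator recovers the one unit lost in the preceding round: \<open>w\<close> is the
  only leaf with an alive neighbour, and all other neighbours of that neighbour \<open>v\<close> are touched.
\<close>

definition credit :: "'a set \<Rightarrow> 'a set set \<Rightarrow> bool" where
  "credit A F \<longleftrightarrow> (\<exists>w\<in>A. \<exists>v\<in>A. leaf F w v \<and>
     (\<forall>f\<in>F. v \<in> f \<and> f \<subseteq> A \<longrightarrow> f = {w, v}) \<and>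
     (\<forall>l\<in>A. \<forall>x\<in>A. leaf F l x \<longrightarrow> l = w))"

lemma leaf_edge: "leaf F l w \<Longrightarrow> {l, w} \<in> F"
  by (auto simp: leaf_def)

lemma leaf_unique: "leaf F l w \<Longrightarrow> f \<in> F \<Longrightarrow> l \<in> f \<Longrightarrow> f = {l, w}"
  by (auto simp: leaf_def)

lemma leafI: "{l, w} \<in> F \<Longrightarrow> (\<And>f. f \<in> F \<Longrightarrow> l \<in> f \<Longrightarrow> f = {l, w}) \<Longrightarrow> leaf F l w"
  unfolding leaf_def by blast

lemma leaf_remove_other: "leaf (F - {e}) l x \<Longrightarrow> l \<notin> e \<Longrightarrow> leaf F l x"
  by (auto simp: leaf_def)

lemma edge_other_end:
  assumes "card e = 2" "x \<in> e"
  obtains y where "e = {x, y}" "x \<noteq> y"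
  using assms by (auto simp: card_2_iff)

lemma nonleaf_other_edge:
  assumes "{u, v} \<in> F" "\<not> leaf F u v"
  obtains f where "f \<in> F" "f \<noteq> {u, v}" "u \<in> f"
  using assms by (auto simp: leaf_def)

section \<open>Change of the potential under a single move\<close>

lemma cost_alive:
  assumes "card e = 2" "e \<subseteq> A"
  shows "cost A e = 3"
proof -
  have "e \<inter> A = e" using assms by blast
  with assms show ?thesis by (auto simp: cost_def)
qed

lemma cost_mono:
  assumes "finite A" "B \<subseteq> A"
  shows "cost B f \<le> cost A f"
proof -
  have "card (f \<inter> B) \<le> card (f \<inter> A)" using assms by (intro card_mono) auto
  then show ?thesis using assms by (auto simp: cost_def)
qed

lemma cost_drop:
  assumes "finite A" "f \<inter> e \<inter> A \<noteq> {}"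
  shows "cost (A - e) f + 1 \<le> cost A f"
proof -
  have "card (f \<inter> (A - e)) < card (f \<inter> A)" using assms by (intro psubset_card_mono) auto
  then show ?thesis using assms by (auto simp: cost_def)
qed

lemma cost_drop_dead:
  assumes "finite A" "f \<inter> A \<noteq> {}" "f \<inter> A \<subseteq> e"
  shows "cost (A - e) f + 2 \<le> cost A f"
proof -
  have "f \<inter> (A - e) = {}" using assms by blast
  moreover have "card (f \<inter> A) > 0" using assms by (simp add: card_gt_0_iff)
  ultimately show ?thesis using assms by (auto simp: cost_def)
qed

lemma potential_no_edges: "potential A {} = 5 * int (card A)"
  by (simp add: potential_def)

lemma potential_isolator:
  assumes "finite A" "finite F" "e \<in> F"
  shows "potential A F + cost A e \<le> potential A (F - {e})"
proof -
  have "card {v \<in> A. \<forall>f\<in>F. v \<notin> f} \<le> card {v \<in> A. \<forall>f\<in>F - {e}. v \<notin> f}"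
    using assms by (intro card_mono) auto
  moreover have "(\<Sum>f\<in>F. cost A f) = cost A e + (\<Sum>f\<in>F - {e}. cost A f)"
    using assms by (intro sum.remove)
  ultimately show ?thesis by (simp add: potential_def)
qed

text \<open>The additional 1 is the bonus of \<open>l\<close>, which becomes isolated. The total
  gain is therefore 4 if \<open>w\<close> is alive and 3 if \<open>w\<close> is touched.\<close>

lemma potential_isolator_leaf:
  assumes "finite A" "finite F" "leaf F l w" "l \<in> A"
  shows "potential A F + cost A {l, w} + 1 \<le> potential A (F - {{l, w}})"
proof -
  have "{v \<in> A. \<forall>f\<in>F. v \<notin> f} \<subset> {v \<in> A. \<forall>f\<in>F - {{l, w}}. v \<notin> f}"
  proof (rule psubsetI)
    have "l \<in> {v \<in> A. \<forall>f\<in>F - {{l, w}}. v \<notin> f}"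
      using assms(4) leaf_unique[OF assms(3)] by auto
    moreover have "l \<notin> {v \<in> A. \<forall>f\<in>F. v \<notin> f}"
      using leaf_edge[OF assms(3)] by auto
    ultimately show "{v \<in> A. \<forall>f\<in>F. v \<notin> f} \<noteq> {v \<in> A. \<forall>f\<in>F - {{l, w}}. v \<notin> f}" by metis
  qed auto
  then have "card {v \<in> A. \<forall>f\<in>F. v \<notin> f} < card {v \<in> A. \<forall>f\<in>F - {{l, w}}. v \<notin> f}"
    using assms by (intro psubset_card_mono) auto
  moreover have "(\<Sum>f\<in>F. cost A f) = cost A {l, w} + (\<Sum>f\<in>F - {{l, w}}. cost A f)"
    using assms leaf_edge by (intro sum.remove) auto
  ultimately show ?thesis by (simp add: potential_def)
qed

text \<open>The bonus term is unchanged: the ends of \<open>e\<close> were not isolated, and no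
  vertex outside \<open>e\<close> loses an edge. The last sum is the refund from edges adjacent to
  \<open>e\<close>, whose alive ends become fewer.\<close>

lemma potential_toucher:
  assumes "finite A" "finite F" "e \<in> F"
  shows "potential (A - e) (F - {e}) = potential A F - 4 * int (card (e \<inter> A)) + cost A e
           + (\<Sum>f\<in>F - {e}. cost A f - cost (A - e) f)"
proof -
  have iso: "{v \<in> A - e. \<forall>f\<in>F - {e}. v \<notin> f} = {v \<in> A. \<forall>f\<in>F. v \<notin> f}"
    using assms by auto
  have "A - e = A - (e \<inter> A)" by blast
  then have "card (A - e) = card A - card (e \<inter> A)"
    using assms by (simp add: card_Diff_subset)
  moreover have "card (e \<inter> A) \<le> card A"
    using assms by (intro card_mono) auto
  ultimately have "int (card (A - e)) = int (card A) - int (card (e \<inter> A))"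
    by simp
  moreover have "(\<Sum>f\<in>F. cost A f) = cost A e + (\<Sum>f\<in>F - {e}. cost A f)"
    using assms by (intro sum.remove)
  ultimately show ?thesis
    unfolding potential_def iso by (simp add: sum_subtractf)
qed

lemma cost_drops:
  assumes "finite A" "finite F" "G \<subseteq> F" "\<And>f. f \<in> G \<Longrightarrow> k \<le> cost A f - cost (A - e) f"
  shows "int (card G) * k \<le> (\<Sum>f\<in>F. cost A f - cost (A - e) f)"
proof -
  have "int (card G) * k = (\<Sum>f\<in>G. k)" by simp
  also have "\<dots> \<le> (\<Sum>f\<in>G. cost A f - cost (A - e) f)"
    using assms(4) by (rule sum_mono)
  also have "\<dots> \<le> (\<Sum>f\<in>F. cost A f - cost (A - e) f)"
    using assms cost_mono[OF assms(1), of "A - e"] by (intro sum_mono2) auto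
  finally show ?thesis .
qed

text \<open>A single alive end loses its 4, but the cost 2 of \<open>e\<close> disappears.\<close>

lemma toucher_loss_dead_end:
  assumes "finite A" "finite F" "e \<in> F" "card e = 2" "\<not> e \<subseteq> A"
  shows "potential A F - (if e \<inter> A = {} then 0 else 2) \<le> potential (A - e) (F - {e})"
proof -
  have "0 \<le> (\<Sum>f\<in>F - {e}. cost A f - cost (A - e) f)"
    using cost_drops[of A "F - {e}" "{}"] assms by simp
  moreover have "finite e" using assms(4) card.infinite by fastforce
  then have "card (e \<inter> A) < card e" using assms by (intro psubset_card_mono) auto
  ultimately show ?thesis
    using assms by (auto simp: potential_toucher cost_def)
qed

text \<open>Two alive ends lose 8 and the cost 3 of \<open>e\<close> disappears, which leaves a loss
  of 5. \<open>G\<close> collects other edges that refund at least \<open>k\<close> each.\<close>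

lemma toucher_loss_alive:
  assumes "finite A" "finite F" "e \<in> F" "card e = 2" "e \<subseteq> A"
    and "G \<subseteq> F - {e}" "\<And>f. f \<in> G \<Longrightarrow> k \<le> cost A f - cost (A - e) f"
  shows "potential A F - 5 + int (card G) * k \<le> potential (A - e) (F - {e})"
proof -
  have "e \<inter> A = e" using assms by blast
  then show ?thesis
    using cost_drops[of A "F - {e}" G k e] assms
    by (simp add: potential_toucher cost_alive)
qed

text \<open>If no further edge met an alive \<open>e\<close>, its two ends would form an alive
  component with an edge, against anchoring. That further edge refunds 1 of the loss of 5.\<close>

lemma toucher_loss_4:
  assumes "finite A" "finite F" "e \<in> F" "card e = 2" "anchored A F"
  shows "potential A F - 4 \<le> potential (A - e) (F - {e})"
proof (cases "e \<subseteq> A")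
  case True
  have "e \<noteq> {}" using assms by auto
  then have "\<not> (\<forall>f\<in>F. f \<inter> e \<noteq> {} \<longrightarrow> f \<subseteq> e)"
    using assms True unfolding anchored_def by (metis inf.idem)
  then obtain f where f: "f \<in> F" "f \<inter> e \<noteq> {}" "\<not> f \<subseteq> e" by blast
  have "cost (A - e) f + 1 \<le> cost A f"
    using f True assms by (intro cost_drop) auto
  then show ?thesis
    using toucher_loss_alive[of A F e "{f}" 1] f True assms by auto
qed (use toucher_loss_dead_end[of A F e] assms in \<open>auto split: if_splits\<close>)

text \<open>If both ends of \<open>e\<close> are alive, neither is a leaf, so each lies on a further
  edge. These two edges are distinct because only \<open>e\<close> contains both ends, and each
  refunds 1.\<close>

lemma toucher_loss_3:
  assumes "finite A" "finite F" "e \<in> F" and two: "\<And>f. f \<in> F \<Longrightarrow> card f = 2"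
    and nl: "\<And>l w. e = {l, w} \<Longrightarrow> l \<in> A \<Longrightarrow> w \<in> A \<Longrightarrow> \<not> leaf F l w"
  shows "potential A F - 3 \<le> potential (A - e) (F - {e})"
proof (cases "e \<subseteq> A")
  case True
  obtain u v where e: "e = {u, v}" "u \<noteq> v"
    using two assms(3) by (meson card_2_iff)
  obtain f where f: "f \<in> F" "f \<noteq> e" "u \<in> f"
    using nonleaf_other_edge[of u v F] nl[of u v] e True assms(3) by auto
  obtain g where g: "g \<in> F" "g \<noteq> e" "v \<in> g"
    using nonleaf_other_edge[of v u F] nl[of v u] e True assms(3) by (auto simp: insert_commute)
  have "f \<noteq> g"
  proof
    assume "f = g"
    then have "e \<subseteq> f" using e f g by auto
    moreover have "finite f" using two f card.infinite by fastforce
    ultimately have "e = f" using two f assms(3) by (intro card_subset_eq) auto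
    then show False using f by simp
  qed
  moreover have "1 \<le> cost A h - cost (A - e) h" if "h \<in> {f, g}" for h
  proof -
    have "h \<inter> e \<inter> A \<noteq> {}" using that f g e True by blast
    from cost_drop[OF assms(1) this] show ?thesis by linarith
  qed
  ultimately show ?thesis
    using toucher_loss_alive[of A F e "{f, g}" 1] f g True assms by auto
qed (use toucher_loss_dead_end[of A F e] assms in \<open>auto split: if_splits\<close>)

text \<open>An edge \<open>f\<close> whose alive ends all lie on \<open>e\<close> loses its whole
  cost, so it alone refunds 2.\<close>

lemma toucher_loss_3_beside_dead:
  assumes "finite A" "finite F" "e \<in> F" "card e = 2" "e \<subseteq> A"
    and "f \<in> F" "f \<noteq> e" "f \<inter> A \<noteq> {}" "f \<inter> A \<subseteq> e"
  shows "potential A F - 3 \<le> potential (A - e) (F - {e})"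
proof -
  have "cost (A - e) f + 2 \<le> cost A f" using assms by (intro cost_drop_dead)
  then show ?thesis using toucher_loss_alive[of A F e "{f}" 2] assms(1-7) by simp
qed

section \<open>Preservation of anchoring and leaves of forests\<close>

text \<open>The removed edge does not meet a set of vertices still alive, so a set closed under
  \<open>F - {e}\<close> was already closed under \<open>F\<close>.\<close>

lemma anchored_toucher: "anchored A F \<Longrightarrow> anchored (A - e) (F - {e})"
  unfolding anchored_def
proof (intro allI impI)
  fix S
  assume anc: "\<forall>S\<subseteq>A. (\<forall>f\<in>F. f \<inter> S \<noteq> {} \<longrightarrow> f \<subseteq> S) \<longrightarrow> (\<forall>f\<in>F. f \<inter> S = {})"
    and S: "S \<subseteq> A - e" and cl: "\<forall>f\<in>F - {e}. f \<inter> S \<noteq> {} \<longrightarrow> f \<subseteq> S"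
  have "S \<subseteq> A" "\<forall>f\<in>F. f \<inter> S \<noteq> {} \<longrightarrow> f \<subseteq> S" using S cl by blast+
  with anc[THEN spec, of S] have "\<forall>f\<in>F. f \<inter> S = {}" by simp
  then show "\<forall>f\<in>F - {e}. f \<inter> S = {}" by blast
qed

text \<open>A set \<open>S\<close> closed after the cut becomes closed before it by adding
  \<open>l\<close> if \<open>w\<close> is in \<open>S\<close>, and by dropping \<open>l\<close>
  otherwise. Anchoring of \<open>F\<close> applies to the adjusted set.\<close>

lemma anchored_isolator_leaf:
  assumes "anchored A F" "leaf F l w" "l \<in> A"
  shows "anchored A (F - {{l, w}})"
  unfolding anchored_def
proof (intro allI impI)
  fix S assume S: "S \<subseteq> A" and cl: "\<forall>f\<in>F - {{l, w}}. f \<inter> S \<noteq> {} \<longrightarrow> f \<subseteq> S"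
  have l: "f = {l, w}" if "f \<in> F" "l \<in> f" for f
    using leaf_unique[OF assms(2) that] .
  show "\<forall>f\<in>F - {{l, w}}. f \<inter> S = {}"
  proof (cases "w \<in> S")
    case True
    have "\<forall>f\<in>F. f \<inter> insert l S \<noteq> {} \<longrightarrow> f \<subseteq> insert l S"
      using cl l True by blast
    then have "\<forall>f\<in>F. f \<inter> insert l S = {}"
      using assms(1,3) S unfolding anchored_def by (metis insert_subset)
    then show ?thesis by blast
  next
    case False
    have "\<forall>f\<in>F. f \<inter> (S - {l}) \<noteq> {} \<longrightarrow> f \<subseteq> S - {l}"
      using cl l False by blast
    then have "\<forall>f\<in>F. f \<inter> (S - {l}) = {}"
      using assms(1) S unfolding anchored_def by (metis Diff_subset order_trans)
    then show ?thesis using l by blast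
  qed
qed

lemma edge_sparse_subset:
  assumes "edge_sparse E" "finite E" "F \<subseteq> E"
  shows "edge_sparse F"
  unfolding edge_sparse_def
proof (intro allI impI)
  fix S :: "'a set" assume S: "finite S \<and> S \<noteq> {}"
  have "card {f \<in> F. f \<subseteq> S} \<le> card {f \<in> E. f \<subseteq> S}"
    using assms by (intro card_mono) auto
  with S assms(1) show "card {f \<in> F. f \<subseteq> S} < card S"
    unfolding edge_sparse_def by (meson order.strict_trans1)
qed

lemma degree_sum:
  assumes "finite S" "finite F"
  shows "(\<Sum>v\<in>S. card {f \<in> F. v \<in> f}) = (\<Sum>f\<in>F. card (f \<inter> S))"
proof -
  have "(\<Sum>v\<in>S. card {f \<in> F. v \<in> f}) = (\<Sum>v\<in>S. \<Sum>f\<in>F. if v \<in> f then 1 else 0)"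
    using assms by (simp add: sum.If_cases Int_def)
  also have "\<dots> = (\<Sum>f\<in>F. \<Sum>v\<in>S. if v \<in> f then 1 else 0)"
    by (rule sum.swap)
  also have "\<dots> = (\<Sum>f\<in>F. card (f \<inter> S))"
    using assms by (simp add: sum.If_cases Int_def conj_commute)
  finally show ?thesis .
qed

text \<open>Inside \<open>S\<close> the degrees sum to at most \<open>2 * (card S - 1)\<close>, and
  the vertices other than \<open>u\<close> already use up that amount. In other words, a tree with
  an edge has at least two leaves.\<close>

lemma sparse_low_degree:
  assumes sp: "edge_sparse F" and fin: "finite F" "finite S" and u: "u \<in> S"
    and two: "\<And>f. f \<in> F \<Longrightarrow> card f = 2"
    and deg: "\<And>v. v \<in> S \<Longrightarrow> v \<noteq> u \<Longrightarrow> 2 \<le> card {f \<in> F. v \<in> f \<and> f \<subseteq> S}"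
  shows "card {f \<in> F. u \<in> f \<and> f \<subseteq> S} = 0"
proof -
  let ?G = "{f \<in> F. f \<subseteq> S}"
  let ?d = "\<lambda>v. card {f \<in> ?G. v \<in> f}"
  have G: "{f \<in> ?G. v \<in> f} = {f \<in> F. v \<in> f \<and> f \<subseteq> S}" for v by auto
  have "(\<Sum>f\<in>?G. card (f \<inter> S)) = (\<Sum>f\<in>?G. 2)"
    using two by (intro sum.cong) (auto simp: Int_absorb2)
  then have "(\<Sum>v\<in>S. ?d v) = 2 * card ?G"
    using degree_sum[of S ?G] fin by simp
  moreover have "card ?G < card S"
    using sp fin u unfolding edge_sparse_def by blast
  moreover have "(\<Sum>v\<in>S. ?d v) = ?d u + (\<Sum>v\<in>S - {u}. ?d v)"
    using fin u by (intro sum.remove)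
  moreover have "(\<Sum>v\<in>S - {u}. 2) \<le> (\<Sum>v\<in>S - {u}. ?d v)"
    using deg unfolding G by (intro sum_mono) auto
  then have "2 * (card S - 1) \<le> (\<Sum>v\<in>S - {u}. ?d v)"
    using fin u by simp
  ultimately have "?d u = 0" by linarith
  then show ?thesis unfolding G .
qed

lemma no_leaf_degree:
  assumes "finite F" "\<And>f. f \<in> F \<Longrightarrow> card f = 2" "f \<in> F" "v \<in> f" "\<And>w. \<not> leaf F v w"
  shows "2 \<le> card {g \<in> F. v \<in> g}"
proof -
  obtain w where w: "f = {v, w}" using edge_other_end assms by metis
  obtain g where g: "g \<in> F" "g \<noteq> f" "v \<in> g"
    using nonleaf_other_edge[of v w F] assms w by auto
  have "card {f, g} \<le> card {g \<in> F. v \<in> g}"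
    using assms g by (intro card_mono) auto
  with g show ?thesis by auto
qed

text \<open>An alive component with an edge that broke off would have two leaves, but the cut lowers
  the degree of only one of its vertices, and there was no alive leaf before.\<close>

lemma anchored_isolator_cut:
  assumes sp: "edge_sparse F" and fin: "finite F" "finite A"
    and two: "\<And>f. f \<in> F \<Longrightarrow> card f = 2" and anc: "anchored A F"
    and nl: "\<And>l w. l \<in> A \<Longrightarrow> \<not> leaf F l w"
    and e: "e \<in> F"
  shows "anchored A (F - {e})"
  unfolding anchored_def
proof (intro allI impI)
  fix S assume S: "S \<subseteq> A" and cl: "\<forall>f\<in>F - {e}. f \<inter> S \<noteq> {} \<longrightarrow> f \<subseteq> S"
  show "\<forall>f\<in>F - {e}. f \<inter> S = {}"
  proof (cases "e \<inter> S \<noteq> {} \<longrightarrow> e \<subseteq> S")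
    case True
    then have "\<forall>f\<in>F. f \<inter> S \<noteq> {} \<longrightarrow> f \<subseteq> S" using cl by blast
    then show ?thesis using anc S unfolding anchored_def by blast
  next
    case False
    then obtain u where u: "u \<in> e" "u \<in> S" by blast
    obtain v where v: "e = {u, v}" using edge_other_end[OF two[OF e] u(1)] by metis
    with False u have vS: "v \<notin> S" by blast
    \<comment> \<open>Isolated vertices of \<open>S\<close> are discarded, so that every vertex left
      except \<open>u\<close> has degree at least 2 inside \<open>S0\<close>.\<close>
    define S0 where "S0 = {s \<in> S. \<exists>f\<in>F. s \<in> f}"
    have sub: "f \<subseteq> S0" if "f \<in> F" "f \<noteq> e" "f \<inter> S0 \<noteq> {}" for f
    proof -
      have "f \<subseteq> S" using cl that S0_def by blast
      then show ?thesis using that S0_def by blast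
    qed
    have "2 \<le> card {f \<in> F. s \<in> f \<and> f \<subseteq> S0}" if s: "s \<in> S0" "s \<noteq> u" for s
    proof -
      obtain f where "f \<in> F" "s \<in> f" using s S0_def by blast
      then have "2 \<le> card {f \<in> F. s \<in> f}"
        using no_leaf_degree[OF fin(1) two] nl s S S0_def by blast
      moreover have "s \<notin> e" using s vS v S0_def by auto
      then have "{f \<in> F. s \<in> f} = {f \<in> F. s \<in> f \<and> f \<subseteq> S0}"
        using sub s by blast
      ultimately show ?thesis by simp
    qed
    moreover have "u \<in> S0" using u e S0_def by blast
    moreover have "finite S0"
      using fin(2) by (rule finite_subset[rotated]) (use S S0_def in blast)
    ultimately have "card {f \<in> F. u \<in> f \<and> f \<subseteq> S0} = 0"
      using sparse_low_degree[OF sp fin(1) _ _ two] by blast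
    then have none: "{f \<in> F. u \<in> f \<and> f \<subseteq> S0} = {}" using fin by simp
    \<comment> \<open>\<open>u\<close> was no leaf, so it keeps an edge besides \<open>e\<close>.
      That edge stays inside \<open>S0\<close>, although \<open>u\<close> has degree 0
      there.\<close>
    obtain g where "g \<in> F" "g \<noteq> e" "u \<in> g"
      using nonleaf_other_edge[of u v F] nl[of u v] u S e v by blast
    then have False using none sub[of g] \<open>u \<in> S0\<close> by blast
    then show ?thesis ..
  qed
qed

text \<open>The degree count is applied to the vertices covered by alive edges. The leaf is one of
  the alive forest only: in \<open>F\<close> it may have further edges to touched vertices.\<close>

lemma alive_leaf_exists:
  assumes sp: "edge_sparse F" and fin: "finite F" "finite A"
    and two: "\<And>f. f \<in> F \<Longrightarrow> card f = 2" and e: "e \<in> F" "e \<subseteq> A"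
  obtains v w where "v \<in> A" "w \<in> A" "leaf {f \<in> F. f \<subseteq> A} v w"
proof (rule ccontr)
  let ?G = "{f \<in> F. f \<subseteq> A}" and ?B = "\<Union>{f \<in> F. f \<subseteq> A}"
  assume no: "\<not> thesis"
  note found = that
  have none: "\<not> leaf ?G v w" if "v \<in> A" for v w
  proof
    assume lf: "leaf ?G v w"
    then have "w \<in> A" using leaf_edge[OF lf] by simp
    then show False using no found[OF that _ lf] by blast
  qed
  have deg: "2 \<le> card {f \<in> F. v \<in> f \<and> f \<subseteq> ?B}" if v: "v \<in> ?B" for v
  proof -
    have "v \<in> A" using v by blast
    then have "2 \<le> card {f \<in> ?G. v \<in> f}"
      using no_leaf_degree[of ?G] v none two fin by auto
    moreover have "{f \<in> ?G. v \<in> f} = {f \<in> F. v \<in> f \<and> f \<subseteq> ?B}" by blast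
    ultimately show ?thesis by simp
  qed
  obtain u where u: "u \<in> e" using two[OF e(1)] by fastforce
  then have uB: "u \<in> ?B" using e by blast
  have "finite ?B" using fin(2) by (rule finite_subset[rotated]) blast
  then have "card {f \<in> F. u \<in> f \<and> f \<subseteq> ?B} = 0"
    using sparse_low_degree[OF sp fin(1) _ uB two deg] by blast
  with deg[OF uB] show False by simp
qed

section \<open>Isolator's strategy\<close>

text \<open>The quantity that Isolator keeps from dropping from one of his turns to the next. The
  added 1 is the unit that a credit position lets him recover.\<close>

definition guarantee :: "'a set \<Rightarrow> 'a set set \<Rightarrow> int" where
  "guarantee A F = potential A F + (if credit A F then 1 else 0)"

lemma guarantee_no_live_leaf:
  "(\<And>l w. l \<in> A \<Longrightarrow> w \<in> A \<Longrightarrow> \<not> leaf F l w) \<Longrightarrow> guarantee A F = potential A F"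
  by (auto simp: guarantee_def credit_def)

lemma potential_le_guarantee: "potential A F \<le> guarantee A F"
  by (simp add: guarantee_def)

text \<open>The conclusion is shared by all move lemmas: the bound on
  \<open>potential A (F - {e})\<close> serves when the game ends with this move, the last conjunct
  covers every reply. With a credit, the gain of 4 meets a reply costing at most 3; without one, a
  reply costing at most 4.\<close>

lemma isolator_live_leaf:
  assumes fin: "finite A" "finite F" and two: "\<And>f. f \<in> F \<Longrightarrow> card f = 2"
    and anc: "anchored A F" and lw: "l \<in> A" "w \<in> A" "leaf F l w"
  shows "\<exists>e\<in>F. anchored A (F - {e}) \<and> guarantee A F \<le> potential A (F - {e}) \<and>
    (\<forall>g\<in>F - {e}. guarantee A F \<le> guarantee (A - g) (F - {e} - {g}))"
proof -
  have gain: "potential A F + 4 \<le> potential A (F - {{x, y}})"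
    if xy: "x \<in> A" "y \<in> A" "leaf F x y" for x y
    using potential_isolator_leaf[OF fin xy(3,1)] cost_alive[of "{x, y}" A]
      two[OF leaf_edge[OF xy(3)]] xy(1,2) by simp
  show ?thesis
  proof (cases "credit A F")
    case True
    then obtain x y where xy: "x \<in> A" "y \<in> A" "leaf F x y"
      and y: "\<forall>f\<in>F. y \<in> f \<and> f \<subseteq> A \<longrightarrow> f = {x, y}"
      and only: "\<forall>l\<in>A. \<forall>z\<in>A. leaf F l z \<longrightarrow> l = x"
      unfolding credit_def by blast
    let ?F = "F - {{x, y}}"
    \<comment> \<open>Among the ends of the removed edge, \<open>x\<close> has no edge left and
      \<open>y\<close> no alive neighbour. Any other such leaf existed before and is excluded by
      \<open>only\<close>.\<close>
    have nl: "\<not> leaf ?F l z" if lz: "l \<in> A" "z \<in> A" for l z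
    proof
      assume lf: "leaf ?F l z"
      have "{l, z} \<in> F" "{l, z} \<noteq> {x, y}" using leaf_edge[OF lf] by auto
      then have "l \<noteq> x" "l \<noteq> y"
        using leaf_unique[OF xy(3), of "{l, z}"] y lz by blast+
      then show False using leaf_remove_other[OF lf] only lz by blast
    qed
    have guar: "guarantee A F = potential A F + 1" using True by (simp add: guarantee_def)
    have "guarantee A F \<le> guarantee (A - g) (?F - {g})" if "g \<in> ?F" for g
      using toucher_loss_3[of A ?F g] fin two nl that gain[OF xy] guar
        potential_le_guarantee[of "A - g" "?F - {g}"] by auto
    then show ?thesis
      using gain[OF xy] guar anchored_isolator_leaf[OF anc xy(3,1)] leaf_edge[OF xy(3)]
      by (intro bexI[of _ "{x, y}"]) auto
  next
    case False
    let ?F = "F - {{l, w}}"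
    have anc': "anchored A ?F" by (rule anchored_isolator_leaf[OF anc lw(3,1)])
    have guar: "guarantee A F = potential A F" using False by (simp add: guarantee_def)
    have "guarantee A F \<le> guarantee (A - g) (?F - {g})" if "g \<in> ?F" for g
      using toucher_loss_4[of A ?F g] fin two anc' that gain[OF lw] guar
        potential_le_guarantee[of "A - g" "?F - {g}"] by auto
    then show ?thesis
      using gain[OF lw] guar anc' leaf_edge[OF lw(3)]
      by (intro bexI[of _ "{l, w}"]) auto
  qed
qed

text \<open>Besides \<open>l\<close>, the move lowers only the degree of the touched vertex
  \<open>w\<close>. Hence no leaf with an alive neighbour arises, and the gain of 3 pays for any
  reply.\<close>

lemma isolator_dead_leaf:
  assumes fin: "finite A" "finite F" and two: "\<And>f. f \<in> F \<Longrightarrow> card f = 2"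
    and anc: "anchored A F" and lw: "l \<in> A" "leaf F l w"
    and nl: "\<And>x y. x \<in> A \<Longrightarrow> y \<in> A \<Longrightarrow> \<not> leaf F x y"
  shows "\<exists>e\<in>F. anchored A (F - {e}) \<and> guarantee A F \<le> potential A (F - {e}) \<and>
    (\<forall>g\<in>F - {e}. guarantee A F \<le> guarantee (A - g) (F - {e} - {g}))"
proof -
  let ?F = "F - {{l, w}}"
  have wA: "w \<notin> A" using nl lw by blast
  then have "{l, w} \<inter> A = {l}" using lw by auto
  then have gain: "potential A F + 3 \<le> potential A ?F"
    using potential_isolator_leaf[OF fin lw(2,1)] by (simp add: cost_def)
  have nl': "\<not> leaf ?F x z" if "x \<in> A" "z \<in> A" for x z
  proof
    assume lf: "leaf ?F x z"
    then have "x \<noteq> l" using leaf_edge[OF lf] leaf_unique[OF lw(2), of "{x, z}"] by blast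
    then show False using leaf_remove_other[OF lf] nl that wA by blast
  qed
  have guar: "guarantee A F = potential A F" by (rule guarantee_no_live_leaf[OF nl])
  have "guarantee A F \<le> guarantee (A - g) (?F - {g})" if "g \<in> ?F" for g
    using toucher_loss_3[of A ?F g] fin two nl' that gain guar
      potential_le_guarantee[of "A - g" "?F - {g}"] by auto
  then show ?thesis
    using gain guar anchored_isolator_leaf[OF anc lw(2,1)] leaf_edge[OF lw(2)]
    by (intro bexI[of _ "{l, w}"]) auto
qed

text \<open>A reply costs at most 2, which an edge with an alive end pays for. Once no edge has an
  alive end, neither player changes the potential. Anchoring is automatic, since a closed set of
  alive vertices meets no edge.\<close>

lemma isolator_no_alive_edge:
  assumes fin: "finite A" "finite F" and two: "\<And>f. f \<in> F \<Longrightarrow> card f = 2"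
    and ne: "F \<noteq> {}" and na: "\<And>f. f \<in> F \<Longrightarrow> \<not> f \<subseteq> A"
  shows "\<exists>e\<in>F. anchored A (F - {e}) \<and> guarantee A F \<le> potential A (F - {e}) \<and>
    (\<forall>g\<in>F - {e}. guarantee A F \<le> guarantee (A - g) (F - {e} - {g}))"
proof -
  have anc: "anchored A (F - {e})" for e
    using na unfolding anchored_def by (meson DiffD1 order_trans)
  have "\<not> leaf F x y" if "x \<in> A" "y \<in> A" for x y
    using leaf_edge[of F x y] na[of "{x, y}"] that by auto
  note guar = guarantee_no_live_leaf[OF this]
  have loss: "potential A (F - {e}) - (if g \<inter> A = {} then 0 else 2)
      \<le> potential (A - g) (F - {e} - {g})" if "g \<in> F - {e}" for e g
    using toucher_loss_dead_end[of A "F - {e}" g] fin two na that by auto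
  show ?thesis
  proof (cases "\<exists>e\<in>F. e \<inter> A \<noteq> {}")
    case True
    then obtain e where e: "e \<in> F" "e \<inter> A \<noteq> {}" by blast
    then have "card (e \<inter> A) > 0" using fin by (simp add: card_gt_0_iff)
    then have gain: "potential A F + 2 \<le> potential A (F - {e})"
      using potential_isolator[OF fin e(1)] e by (simp add: cost_def)
    have "guarantee A F \<le> guarantee (A - g) (F - {e} - {g})" if "g \<in> F - {e}" for g
      using gain loss[OF that] potential_le_guarantee[of "A - g" "F - {e} - {g}"] guar
      by (auto split: if_splits)
    then show ?thesis using e anc gain guar by (intro bexI[of _ e]) auto
  next
    case False
    obtain e where e: "e \<in> F" using ne by blast
    then have gain: "potential A F \<le> potential A (F - {e})"
      using potential_isolator[OF fin e(1)] False by (simp add: cost_def)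
    have "guarantee A F \<le> guarantee (A - g) (F - {e} - {g})" if "g \<in> F - {e}" for g
      using gain loss[OF that] potential_le_guarantee[of "A - g" "F - {e} - {g}"] guar False that
      by (auto split: if_splits)
    then show ?thesis using e anc gain guar by (intro bexI[of _ e]) auto
  qed
qed

lemma isolator_cut:
  assumes fin: "finite A" "finite F" and two: "\<And>f. f \<in> F \<Longrightarrow> card f = 2"
    and sp: "edge_sparse F" and anc: "anchored A F"
    and nl: "\<And>l w. l \<in> A \<Longrightarrow> \<not> leaf F l w"
    and alive: "e0 \<in> F" "e0 \<subseteq> A"
  shows "\<exists>e\<in>F. anchored A (F - {e}) \<and> guarantee A F \<le> potential A (F - {e}) \<and>
    (\<forall>g\<in>F - {e}. guarantee A F \<le> guarantee (A - g) (F - {e} - {g}))"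
proof -
  have guar: "guarantee A F = potential A F"
    using nl by (intro guarantee_no_live_leaf)
  have anc': "anchored A (F - {e})" if "e \<in> F" for e
    using anchored_isolator_cut[OF sp fin(2,1) two anc nl that] by blast
  have gain: "potential A F + 3 \<le> potential A (F - {e})" if "e \<in> F" "e \<subseteq> A" for e
    using potential_isolator[OF fin that(1)] cost_alive[OF two that(2)] that by simp
  obtain v w where vw: "v \<in> A" "w \<in> A" "leaf {f \<in> F. f \<subseteq> A} v w"
    using alive_leaf_exists[OF sp fin(2,1) two alive] by blast
  have vwF: "{v, w} \<in> F" using leaf_edge[OF vw(3)] by auto
  have vnbr: "f = {v, w}" if "f \<in> F" "v \<in> f" "f \<subseteq> A" for f
    using leaf_unique[OF vw(3)] that by auto
  have vw_ne: "v \<noteq> w" using two[OF vwF] by auto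
  \<comment> \<open>The split is whether cutting \<open>{v, w}\<close> would create a leaf with an
    alive neighbour, the only situation in which a reply could cost 4.\<close>
  show ?thesis
  proof (cases "\<exists>l\<in>A. \<exists>x\<in>A. leaf (F - {{v, w}}) l x")
    case False
    let ?F = "F - {{v, w}}"
    have loss: "potential A ?F - 3 \<le> potential (A - g) (?F - {g})" if "g \<in> ?F" for g
      using toucher_loss_3[of A ?F g] fin two False that by auto
    have "guarantee A F \<le> guarantee (A - g) (?F - {g})" if "g \<in> ?F" for g
      using loss[OF that] gain[of "{v, w}"] vwF vw guar
        potential_le_guarantee[of "A - g" "?F - {g}"] by simp
    then show ?thesis using gain[of "{v, w}"] vwF vw anc' guar
      by (intro bexI[of _ "{v, w}"]) auto
  next
    case True
    then obtain l x where lx: "l \<in> A" "x \<in> A" "leaf (F - {{v, w}}) l x" by blast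
    have "l \<in> {v, w}" using leaf_remove_other[OF lx(3)] nl lx(1) by blast
    moreover have "l \<noteq> v" using vnbr[of "{l, x}"] leaf_edge[OF lx(3)] lx by auto
    ultimately have "l = w" by blast
    with lx have x: "x \<in> A" "leaf (F - {{v, w}}) w x" by auto
    have wx: "{w, x} \<in> F" "{w, x} \<noteq> {v, w}" using leaf_edge[OF x(2)] by auto
    have wnbr: "f = {v, w} \<or> f = {w, x}" if "f \<in> F" "w \<in> f" for f
      using leaf_unique[OF x(2), of f] that by auto
    have ne: "x \<noteq> w" "x \<noteq> v" using two[OF wx(1)] wx by auto
    let ?F = "F - {{w, x}}"
    have wleaf: "leaf ?F w v"
      using vwF wx wnbr by (intro leafI) (auto simp: insert_commute)
    \<comment> \<open>There was no alive leaf before, so only the ends of the cut edge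
      \<open>{w, x}\<close> can have become leaves.\<close>
    have leaves: "l = w \<or> l = x" if "l \<in> A" "leaf ?F l z" for l z
      using leaf_remove_other[OF that(2)] nl that by blast
    \<comment> \<open>\<open>v\<close> is no leaf of \<open>F\<close>, but \<open>w\<close> is its
      only alive neighbour. So \<open>d\<close> leads to a touched vertex and refunds 2 as soon as
      \<open>v\<close> is touched.\<close>
    obtain d where d: "d \<in> F" "d \<noteq> {v, w}" "v \<in> d"
      using nonleaf_other_edge[of v w F] vwF nl vw by blast
    have dA: "d \<inter> A = {v}"
    proof -
      obtain z where z: "d = {v, z}" using edge_other_end[OF two[OF d(1)] d(3)] by metis
      then have "z \<notin> A" using vnbr[OF d(1,3)] d(2) vw by auto
      then show ?thesis using z vw by auto
    qed
    have "potential A ?F - 3 \<le> guarantee (A - g) (?F - {g})" if g: "g \<in> ?F" for g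
    proof (cases "\<exists>l z. g = {l, z} \<and> l \<in> A \<and> z \<in> A \<and> leaf ?F l z")
      case False
      then have "potential A ?F - 3 \<le> potential (A - g) (?F - {g})"
        using toucher_loss_3[of A ?F g] fin two g by auto
      then show ?thesis using potential_le_guarantee[of "A - g" "?F - {g}"] by linarith
    next
      case True
      then obtain l z where lz: "g = {l, z}" "l \<in> A" "z \<in> A" "leaf ?F l z" by blast
      consider "l = w" | "l = x" "l \<noteq> w" using leaves lz by blast
      then show ?thesis
      proof cases
        case 1
        then have g_eq: "g = {v, w}"
          using leaf_unique[OF wleaf, of g] g lz by (auto simp: insert_commute)
        have "d \<noteq> {w, x}" using d ne vw_ne by auto
        then have "potential A ?F - 3 \<le> potential (A - g) (?F - {g})"
          using toucher_loss_3_beside_dead[of A ?F g d] fin two g g_eq d dA vw by auto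
        then show ?thesis using potential_le_guarantee[of "A - g" "?F - {g}"] by linarith
      next
        case 2
        have "z \<noteq> w" using g lz 2 by (auto simp: insert_commute)
        moreover have "z \<noteq> v" using vnbr[of g] g lz 2 ne by auto
        \<comment> \<open>This reply touches the leaf \<open>x\<close> and may cost 4. It misses
          \<open>v\<close> and \<open>w\<close>, so \<open>w\<close> remains a leaf at
          \<open>v\<close> and is now the only alive leaf: the credit makes up for the fourth
          unit.\<close>
        ultimately have out: "w \<notin> g" "v \<notin> g" using lz 2 ne by auto
        have "leaf (?F - {g}) w v"
          using wleaf out by (auto simp: leaf_def)
        moreover have "f = {w, v}" if "f \<in> ?F - {g}" "v \<in> f" "f \<subseteq> A - g" for f
          using vnbr[of f] that by (auto simp: insert_commute)
        moreover have "k = w" if "k \<in> A - g" "leaf (?F - {g}) k y" for k y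
          using leaf_remove_other[OF that(2)] leaves[of k y] that lz 2 by auto
        ultimately have "credit (A - g) (?F - {g})"
          using out vw unfolding credit_def by blast
        then show ?thesis
          using toucher_loss_4[of A ?F g] fin two g anc'[OF wx(1)] by (simp add: guarantee_def)
      qed
    qed
    then have "\<forall>g\<in>?F. guarantee A F \<le> guarantee (A - g) (?F - {g})"
      using gain[of "{w, x}"] wx x vw guar by fastforce
    then show ?thesis using gain[of "{w, x}"] wx x vw anc' guar
      by (intro bexI[of _ "{w, x}"]) auto
  qed
qed

lemma isolator_good_move:
  assumes fin: "finite A" "finite F" and two: "\<And>f. f \<in> F \<Longrightarrow> card f = 2"
    and sp: "edge_sparse F" and anc: "anchored A F" and ne: "F \<noteq> {}"
  shows "\<exists>e\<in>F. anchored A (F - {e}) \<and> guarantee A F \<le> potential A (F - {e}) \<and>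
    (\<forall>g\<in>F - {e}. guarantee A F \<le> guarantee (A - g) (F - {e} - {g}))"
proof -
  consider l w where "l \<in> A" "w \<in> A" "leaf F l w"
    | l w where "l \<in> A" "leaf F l w" "\<And>x y. x \<in> A \<Longrightarrow> y \<in> A \<Longrightarrow> \<not> leaf F x y"
    | e where "\<And>l w. l \<in> A \<Longrightarrow> \<not> leaf F l w" "e \<in> F" "e \<subseteq> A"
    | "\<And>f. f \<in> F \<Longrightarrow> \<not> f \<subseteq> A"
    by blast
  then show ?thesis
  proof cases
    case 1 then show ?thesis using isolator_live_leaf[OF fin two anc] by blast
  next
    case 2 then show ?thesis using isolator_dead_leaf[OF fin two anc] by blast
  next
    case 3 then show ?thesis using isolator_cut[OF fin two sp anc] by blast
  next
    case 4 then show ?thesis using isolator_no_alive_edge[OF fin two ne] by blast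
  qed
qed

section \<open>From the strategy to the value of the game\<close>

lemma position_value_end:
  assumes "E - (T \<union> I) = {}" "T \<inter> I = {}" "T \<subseteq> E"
  shows "position_value V E p T I = card (V - \<Union>T)"
proof -
  have "untouched V E I = V - \<Union>T" using assms unfolding untouched_def by blast
  then show ?thesis using assms by (cases p) (simp_all add: position_value.simps)
qed

lemma position_value_isolator:
  assumes "finite E" "e \<in> E - (T \<union> I)"
  shows "position_value V E Toucher T (insert e I) \<le> position_value V E Isolator T I"
  using assms by (subst position_value.simps(2)) auto

lemma position_value_toucher:
  assumes "finite E" "E - (T \<union> I) \<noteq> {}"
    and "\<And>e. e \<in> E - (T \<union> I) \<Longrightarrow> k \<le> 5 * int (position_value V E Isolator (insert e T) I)"
  shows "k \<le> 5 * int (position_value V E Toucher T I)"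
proof -
  let ?P = "(\<lambda>e. position_value V E Isolator (insert e T) I) ` (E - (T \<union> I))"
  have "position_value V E Toucher T I = Min ?P"
    using assms(1,2) by (subst position_value.simps(1)) auto
  moreover have "Min ?P \<in> ?P" using assms(1,2) by (intro Min_in) auto
  ultimately obtain e where "e \<in> E - (T \<union> I)"
    "position_value V E Toucher T I = position_value V E Isolator (insert e T) I"
    by (metis (no_types, lifting) imageE)
  then show ?thesis using assms(3) by metis
qed

text \<open>Induction over full rounds, each an Isolator move followed by a Toucher reply. When no
  edge is left there is no credit, and each alive vertex is worth exactly 5.\<close>

lemma isolator_guarantee:
  assumes fin: "finite V" "finite E" and two: "\<And>f. f \<in> E \<Longrightarrow> card f = 2"
    and sp: "edge_sparse E"
    and "T \<subseteq> E" "T \<inter> I = {}" "anchored (V - \<Union>T) (E - (T \<union> I))"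
  shows "guarantee (V - \<Union>T) (E - (T \<union> I)) \<le> 5 * int (position_value V E Isolator T I)"
  using assms(5-)
proof (induction "card (E - (T \<union> I))" arbitrary: T I rule: less_induct)
  case less
  let ?A = "V - \<Union>T" and ?F = "E - (T \<union> I)"
  show ?case
  proof (cases "?F = {}")
    case True
    have "guarantee ?A {} = potential ?A {}"
      by (rule guarantee_no_live_leaf) (simp add: leaf_def)
    then show ?thesis
      unfolding True position_value_end[OF True less.prems(2,1)] by (simp add: potential_no_edges)
  next
    case False
    have finF: "finite ?A" "finite ?F" using fin by auto
    have twoF: "card f = 2" if "f \<in> ?F" for f using two that by blast
    have spF: "edge_sparse ?F" by (rule edge_sparse_subset[OF sp fin(2)]) blast
    obtain e where e: "e \<in> ?F" and anc: "anchored ?A (?F - {e})"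
      and stop: "guarantee ?A ?F \<le> potential ?A (?F - {e})"
      and reply: "\<And>g. g \<in> ?F - {e} \<Longrightarrow> guarantee ?A ?F \<le> guarantee (?A - g) (?F - {e} - {g})"
      using isolator_good_move[OF finF twoF spF less.prems(3) False] by blast
    have F_e: "E - (T \<union> insert e I) = ?F - {e}" by blast
    have disj: "T \<inter> insert e I = {}" using less.prems e by blast
    have "guarantee ?A ?F \<le> 5 * int (position_value V E Toucher T (insert e I))"
    \<comment> \<open>If Isolator takes the last edge there is no reply, and \<open>stop\<close>
      gives the bound directly.\<close>
    proof (cases "?F - {e} = {}")
      case True
      then have "position_value V E Toucher T (insert e I) = card ?A"
        using less.prems disj F_e by (intro position_value_end) auto
      then show ?thesis using stop True by (simp add: potential_no_edges)
    next
      case nonempty: False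
      have "guarantee ?A ?F \<le> 5 * int (position_value V E Isolator (insert g T) (insert e I))"
        if g: "g \<in> ?F - {e}" for g
      proof -
        have F_g: "E - (insert g T \<union> insert e I) = ?F - {e} - {g}" by blast
        have A_g: "V - \<Union>(insert g T) = ?A - g" by blast
        have "?F - {e} - {g} \<subset> ?F" using e by blast
        then have "card (?F - {e} - {g}) < card ?F" using finF by (simp add: psubset_card_mono)
        then have "guarantee (?A - g) (?F - {e} - {g})
            \<le> 5 * int (position_value V E Isolator (insert g T) (insert e I))"
          using less.hyps[of "insert g T" "insert e I"] less.prems g e
            anchored_toucher[OF anc, of g]
          unfolding F_g A_g by auto
        with reply[OF g] show ?thesis by linarith
      qed
      then show ?thesis
        using nonempty position_value_toucher[OF fin(2), of T "insert e I"] unfolding F_e by blast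
    qed
    then show ?thesis using position_value_isolator[OF fin(2) e, of V] by linarith
  qed
qed

section \<open>Acyclic and connected graphs\<close>

text \<open>Longest path argument: the first vertex has an edge other than the one to its successor.
  By maximality this edge leads back into the path and closes a cycle.\<close>

lemma min_degree_2_cycle:
  assumes "finite S" "S \<noteq> {}" and two: "\<And>f. f \<in> E \<Longrightarrow> card f = 2"
    and deg: "\<And>v. v \<in> S \<Longrightarrow> 2 \<le> card {f \<in> E. v \<in> f \<and> f \<subseteq> S}"
  shows "\<exists>p. graph_cycle E p"
proof -
  define path where "path p \<longleftrightarrow> p \<noteq> [] \<and> distinct p \<and> set p \<subseteq> S \<and>
    (\<forall>i. Suc i < length p \<longrightarrow> {p ! i, p ! Suc i} \<in> E)" for p
  have bound: "length p < Suc (card S)" if "path p" for p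
    using that assms(1) card_mono[of S "set p"] by (simp add: path_def distinct_card)
  obtain s where "s \<in> S" using assms(2) by blast
  then have "path [s]" by (simp add: path_def)
  then obtain p where p: "path p" and longest: "\<And>q. path q \<Longrightarrow> length q \<le> length p"
    using ex_has_greatest_nat[of path "[s]" length "Suc (card S)"] bound by blast
  obtain x xs where xs: "p = x # xs" using p by (cases p) (auto simp: path_def)
  let ?G = "{f \<in> E. x \<in> f \<and> f \<subseteq> S}"
  have "x \<in> S" using p xs by (auto simp: path_def)
  \<comment> \<open>If \<open>xs\<close> is empty, \<open>hd xs\<close> is an unspecified value.
    This is harmless, since in any case only one edge is excluded while the degree is at least
    2.\<close>
  have "\<not> ?G \<subseteq> {{x, hd xs}}"
    using deg[OF \<open>x \<in> S\<close>] card_mono[of "{{x, hd xs}}" ?G] by auto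
  then obtain f where f: "f \<in> E" "x \<in> f" "f \<subseteq> S" "f \<noteq> {x, hd xs}" by blast
  obtain y where y: "f = {x, y}" "x \<noteq> y" using edge_other_end[OF two[OF f(1)] f(2)] by metis
  have "y \<in> set p"
  proof (rule ccontr)
    assume "y \<notin> set p"
    then have "path (y # p)"
      using p f y xs unfolding path_def
      by (auto simp: nth_Cons insert_commute split: nat.splits)
    then show False using longest by fastforce
  qed
  then obtain j where j: "j < length p" "p ! j = y" by (auto simp: in_set_conv_nth)
  have "j \<noteq> 0" using j y xs by (cases j) auto
  moreover have "j \<noteq> 1" using j y f xs by (cases xs) auto
  ultimately have "2 \<le> j" by linarith
  \<comment> \<open>The initial segment from \<open>x\<close> to \<open>y\<close> has at least three
    vertices because \<open>2 \<le> j\<close>; \<open>f\<close> is its closing edge, reached where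
    the index wraps around to 0.\<close>
  have "graph_cycle E (take (Suc j) p)"
    unfolding graph_cycle_def
  proof (intro conjI allI impI)
    have len: "length (take (Suc j) p) = Suc j" using j by simp
    show "3 \<le> length (take (Suc j) p)" using len \<open>2 \<le> j\<close> by simp
    show "distinct (take (Suc j) p)" using p by (simp add: path_def)
    fix i assume "i < length (take (Suc j) p)"
    then have i: "i \<le> j" using len by simp
    show "{take (Suc j) p ! i, take (Suc j) p ! (Suc i mod length (take (Suc j) p))} \<in> E"
    proof (cases "i = j")
      case True
      moreover have "take (Suc j) p ! j = y" "take (Suc j) p ! 0 = x"
        using j xs by (auto simp del: take_Suc_Cons)
      ultimately show ?thesis using len y f by (simp add: insert_commute)
    next
      case False
      then show ?thesis using len i j p by (simp add: path_def)
    qed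
  qed
  then show ?thesis by blast
qed

text \<open>Without a cycle, some vertex of \<open>S\<close> lies on at most one edge inside
  \<open>S\<close>. Deleting it removes one vertex and at most one edge. Singletons are the base
  case, as sparsity concerns nonempty sets.\<close>

lemma acyclic_edge_sparse:
  assumes "finite E" and two: "\<And>f. f \<in> E \<Longrightarrow> card f = 2" and acyc: "\<nexists>p. graph_cycle E p"
  shows "edge_sparse E"
proof -
  have "card {f \<in> E. f \<subseteq> S} < card S" if "finite S" "S \<noteq> {}" for S :: "'a set"
    using that
  proof (induction S rule: finite_psubset_induct)
    case (psubset S)
    obtain v where v: "v \<in> S" "card {f \<in> E. v \<in> f \<and> f \<subseteq> S} < 2"
      using min_degree_2_cycle[OF psubset.hyps(1) psubset.prems two] acyc by (meson not_le)
    have split: "{f \<in> E. f \<subseteq> S} = {f \<in> E. v \<in> f \<and> f \<subseteq> S} \<union> {f \<in> E. f \<subseteq> S - {v}}" by blast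
    have le: "card {f \<in> E. f \<subseteq> S} \<le>
        card {f \<in> E. v \<in> f \<and> f \<subseteq> S} + card {f \<in> E. f \<subseteq> S - {v}}"
      by (subst split) (rule card_Un_le)
    show ?case
    proof (cases "S = {v}")
      case True
      have "{f \<in> E. f \<subseteq> S} = {}"
        using two True by (fastforce dest!: subset_singletonD)
      then show ?thesis using True by simp
    next
      case False
      then have "card {f \<in> E. f \<subseteq> S - {v}} < card (S - {v})"
        using psubset.IH[of "S - {v}"] v by blast
      moreover have "card (S - {v}) = card S - 1" "card S > 0"
        using psubset v by (auto simp: card_gt_0_iff)
      ultimately show ?thesis using le v by linarith
    qed
  qed
  then show ?thesis unfolding edge_sparse_def by blast
qed

lemma connected_closed_set:
  assumes "connected_graph V E" "S \<subseteq> V" "S \<noteq> {}"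
    and cl: "\<forall>f\<in>E. f \<inter> S \<noteq> {} \<longrightarrow> f \<subseteq> S"
  shows "S = V"
proof -
  obtain s where s: "s \<in> S" using assms by blast
  have "v \<in> S" if "v \<in> V" for v
  proof -
    have "(s, v) \<in> {(x, y). {x, y} \<in> E}\<^sup>*"
      using assms s that unfolding connected_graph_def by blast
    then show ?thesis
      by (induction rule: rtrancl_induct) (use s cl in auto)
  qed
  with assms(2) show ?thesis by blast
qed

theorem theorem1p1:
  fixes V :: "'a set" and E :: "'a set set" and n :: nat
  assumes "tree_graph V E" and "card V = n" and "n \<ge> 3"
  shows "int (game_value V E) \<ge> \<lfloor>(real n + 3) / 5\<rfloor>"
proof -
  have finV: "finite V" and EV: "\<And>f. f \<in> E \<Longrightarrow> f \<subseteq> V" and two: "\<And>f. f \<in> E \<Longrightarrow> card f = 2"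
    and conn: "connected_graph V E" and acyc: "\<nexists>p. graph_cycle E p"
    using assms(1) unfolding tree_graph_def simple_graph_def by auto
  have finE: "finite E"
    using finV EV by (intro finite_subset[of E "Pow V"]) auto
  have sp: "edge_sparse E" by (rule acyclic_edge_sparse[OF finE two acyc])
  have "V \<noteq> {}" using assms by auto
  have "{f \<in> E. f \<subseteq> V} = E" using EV by blast
  then have "card E < n"
    using sp finV \<open>V \<noteq> {}\<close> assms(2) unfolding edge_sparse_def by metis
  moreover have "(\<Sum>f\<in>E. cost V f) = (\<Sum>f\<in>E. 3)"
    by (intro sum.cong refl cost_alive two EV)
  \<comment> \<open>At most \<open>n - 1\<close> edges cost 3 each, which gives
    \<open>4 * n - 3 * (n - 1)\<close>; the bonus for isolated vertices is nonnegative.\<close>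
  ultimately have start: "int n + 3 \<le> potential V E"
    using assms(2) by (simp add: potential_def)
  have proper: "\<exists>f\<in>E. f \<inter> S \<noteq> {} \<and> \<not> f \<subseteq> S" if "S \<subseteq> V" "S \<noteq> {}" "S \<noteq> V" for S
    using connected_closed_set[OF conn] that by blast
  have E_ne: "E \<noteq> {}"
  proof -
    obtain s where "s \<in> V" using \<open>V \<noteq> {}\<close> by blast
    moreover have "{s} \<noteq> V" using assms by auto
    ultimately show ?thesis using proper[of "{s}"] by blast
  qed
  \<comment> \<open>Here \<open>n - 1\<close> is \<open>n + 3\<close> minus the 4 lost in the first
    move. The initial position is not anchored, as \<open>V\<close> itself is an alive component, so
    \<open>toucher_loss_4\<close> does not apply; connectivity and \<open>n \<ge> 3\<close> supply
    the edge leaving \<open>e\<close> instead.\<close>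
  have after: "int n - 1 \<le> 5 * int (position_value V E Isolator {e} {})" if e: "e \<in> E" for e
  proof -
    have "e \<noteq> {}" "e \<noteq> V" using two[OF e] assms by auto
    then obtain f where f: "f \<in> E" "f \<inter> e \<noteq> {}" "\<not> f \<subseteq> e"
      using proper EV[OF e] by blast
    have "cost (V - e) f + 1 \<le> cost V f"
      using cost_drop[of V f e] finV f EV by blast
    then have "potential V E - 4 \<le> potential (V - e) (E - {e})"
      using toucher_loss_alive[of V E e "{f}" 1] finV finE e two EV f by auto
    moreover have "anchored (V - e) (E - {e})"
      unfolding anchored_def
    proof (intro allI impI)
      fix S assume S: "S \<subseteq> V - e" "\<forall>f\<in>E - {e}. f \<inter> S \<noteq> {} \<longrightarrow> f \<subseteq> S"
      then have "\<forall>f\<in>E. f \<inter> S \<noteq> {} \<longrightarrow> f \<subseteq> S" by blast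
      moreover have "S \<noteq> V" using S \<open>e \<noteq> {}\<close> EV[OF e] by blast
      ultimately have "S = {}" using proper[of S] S by blast
      then show "\<forall>f\<in>E - {e}. f \<inter> S = {}" by simp
    qed
    then have "guarantee (V - e) (E - {e}) \<le> 5 * int (position_value V E Isolator {e} {})"
      using isolator_guarantee[OF finV finE two sp, of "{e}" "{}"] e by simp
    ultimately show ?thesis
      using start potential_le_guarantee[of "V - e" "E - {e}"] by linarith
  qed
  have "int n - 1 \<le> 5 * int (game_value V E)"
    unfolding game_value_def using E_ne after
    by (intro position_value_toucher[OF finE]) auto
  \<comment> \<open>The score is an integer, so the bound \<open>(n - 1) / 5\<close> rounds up to
    \<open>(n + 3) div 5\<close>.\<close>
  then have "(int n + 3) div 5 \<le> int (game_value V E)" by linarith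
  moreover have "\<lfloor>(real n + 3) / 5\<rfloor> = (int n + 3) div 5"
    using floor_divide_of_int_eq[of "int n + 3" 5, where 'a = real] by simp
  ultimately show ?thesis by simp
qed

end
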